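(* Let $\chi,\rho_{12},\rho_{23},\rho_{31}\in\mathbb R$. In the complex Albert algebra $J_3(\mathbb O_{\mathbb C})$ put $$z_{12}=-\cos\chi\,e_3+\sin\chi\,e_1,\qquad z_{23}=\cos\chi\,e_6+\sin\chi\,e_1,\qquad z_{31}=\cos\chi\,e_4+\sin\chi\,e_1,$$ $$\mathcal D_{12}(z)=2[L_{p_1-p_2},L_{F_3(z)}],\quad \mathcal D_{23}(z)=2[L_{p_2-p_3},L_{F_1(z)}],\quad \mathcal D_{31}(z)=2[L_{p_3-p_1},L_{F_2(z)}],$$ $$\mathcal B=\rho_{12}\mathcal D_{12}(z_{12})+\rho_{23}\mathcal D_{23}(z_{23})+\rho_{31}\mathcal D_{31}(z_{31}),$$ and $$\nu_1=F_3(ie_7),\qquad\nu_2=F_1(ie_5),\qquad\nu_3=F_2(ie_2).$$ Let $P_\nu$ be the projection onto the real span of $\nu_1,\nu_2,\nu_3$. Then, in the basis $(\nu_1,\nu_2,\nu_3)$, $$P_\nu\mathcal BP_\nu=\cos\chi\begin{pmatrix} 0 & -\rho_{31} & \rho_{23} \\ \rho_{31} & 0 & -\rho_{12} \\ -\rho_{23} & \rho_{12} & 0 \end{pmatrix}$$ (up to simultaneous edge-orientation conventions). In particular only the $e_3,e_6,e_4$ components of $z_{12},z_{23},z_{31}$ contribute, and their $e_1$ components project to zero.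
   Context: $\mathbb O_{\mathbb C}=\mathbb C\otimes\mathbb O$ is the complexified octonion algebra with imaginary units $e_1,\dots,e_7$, $e_k^2=-1$, $e_ke_{k+1}=e_{k+3}$ (indices mod $7$ in $\{1,\dots,7\}$), each such triple multiplying cyclically like quaternion units and distinct imaginary units anticommuting; $i$ is the central complex unit and the bar is the $\mathbb C$-linear octonionic conjugation. Elements of $J_3(\mathbb O_{\mathbb C})$ are matrices $\begin{pmatrix} \xi_1 & x_3 & \bar x_2 \\ \bar x_3 & \xi_2 & x_1 \\ x_2 & \bar x_1 & \xi_3 \end{pmatrix}$ with $\xi_i\in\mathbb C$, $x_i\in\mathbb O_{\mathbb C}$, product $A\circ B=\frac12(AB+BA)$, and $L_A(X)=A\circ X$. $p_i=E_{ii}$ and $F_i(x)$ is the matrix with $x_i=x$ and all other coordinates zero. $P_\nu$ is the orthogonal projection for the real inner product in which the elements $p_j,\ ip_j,\ F_j(e_k),\ iF_j(e_k)$ ($j=1,2,3$, $k=0,\dots,7$, $e_0=1$) are orthonormal. *)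

theory Defs
  imports "HOL-Analysis.Analysis"
begin

section \<open>Complexified octonions\<close>

text \<open>
  Coordinates are indexed by \<^typ>\<open>7 option\<close>: index \<open>None\<close> belongs to \<open>e\<^sub>0 = 1\<close> and index \<open>Some k\<close>
  to the imaginary unit \<open>e\<^sub>k\<close>. Arithmetic in \<^typ>\<open>7\<close> is modulo 7 and the numeral \<open>7\<close> denotes the same
  index as \<open>0\<close>, so \<open>e\<^sub>1, \<dots>, e\<^sub>7\<close> are the seven imaginary units. Complex scalars act by \<open>*s\<close>. The
  operations \<open>*\<close> and \<open>1\<close> which the library defines on vectors are componentwise and are not used.
\<close>

type_synonym octc = "complex ^ 7 option"

definition oone :: octc where
  "oone = axis None 1"

definition e :: "7 \<Rightarrow> octc" where
  "e k = axis (Some k) 1"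

text \<open>
  The coefficient of \<open>e\<^sub>m\<close> collects the three ways in which \<open>m\<close> occurs in a triple \<open>(k, k+1, k+3)\<close>.
\<close>

definition omult :: "octc \<Rightarrow> octc \<Rightarrow> octc" (infixl "\<odot>" 70) where
  "x \<odot> y = (\<chi> n. case n of
     None \<Rightarrow> x $ None * y $ None - (\<Sum>k\<in>UNIV. x $ Some k * y $ Some k)
   | Some m \<Rightarrow> x $ None * y $ Some m + x $ Some m * y $ None
       + (x $ Some (m - 3) * y $ Some (m - 2) - x $ Some (m - 2) * y $ Some (m - 3))
       + (x $ Some (m + 1) * y $ Some (m + 3) - x $ Some (m + 3) * y $ Some (m + 1))
       + (x $ Some (m + 2) * y $ Some (m - 1) - x $ Some (m - 1) * y $ Some (m + 2)))"

definition oconj :: "octc \<Rightarrow> octc" where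
  "oconj x = (\<chi> n. case n of None \<Rightarrow> x $ None | Some m \<Rightarrow> - (x $ Some m))"

lemma UNIV_7: "(UNIV :: 7 set) = {1, 2, 3, 4, 5, 6, 7}"
proof -
  have "card {1, 2, 3, 4, 5, 6, 7 :: 7} = CARD(7)"
    by simp
  then show ?thesis
    by (metis card_subset_eq finite_class.finite_UNIV subset_UNIV)
qed

lemma omult_nth:
  "(x \<odot> y) $ None = x $ None * y $ None - (\<Sum>k\<in>UNIV. x $ Some k * y $ Some k)"
  "(x \<odot> y) $ Some m = x $ None * y $ Some m + x $ Some m * y $ None
       + (x $ Some (m - 3) * y $ Some (m - 2) - x $ Some (m - 2) * y $ Some (m - 3))
       + (x $ Some (m + 1) * y $ Some (m + 3) - x $ Some (m + 3) * y $ Some (m + 1))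
       + (x $ Some (m + 2) * y $ Some (m - 1) - x $ Some (m - 1) * y $ Some (m + 2))"
  by (simp_all add: omult_def)

lemma oconj_nth:
  "oconj x $ None = x $ None" "oconj x $ Some m = - (x $ Some m)"
  by (simp_all add: oconj_def)

lemma octc_eqI:
  fixes x y :: octc
  assumes "x $ None = y $ None" "\<And>m. x $ Some m = y $ Some m"
  shows "x = y"
  using assms by (metis option.exhaust vec_eq_iff)

lemma oone_nth: "oone $ None = 1" "oone $ Some m = 0"
  by (simp_all add: oone_def axis_def)

lemma e_nth: "e k $ None = 0" "e k $ Some m = (if m = k then 1 else 0)"
  by (simp_all add: e_def axis_def)

lemma omult_one: "oone \<odot> x = x" "x \<odot> oone = x"
  by (auto intro!: octc_eqI simp: omult_nth oone_nth)

lemma e_square: "e k \<odot> e k = - oone"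
  by (auto intro!: octc_eqI simp: omult_nth oone_nth e_nth mult_delta_left)

lemma e_triple:
  "e k \<odot> e (k + 1) = e (k + 3)"
  "e (k + 1) \<odot> e (k + 3) = e k"
  "e (k + 3) \<odot> e k = e (k + 1)"
proof -
  have shift: "\<exists>d\<in>{1, 2, 3, 4, 5, 6, 7}. m = k + d" for m
    unfolding UNIV_7[symmetric] by (metis UNIV_I add.commute diff_add_cancel)
  have *: "(e k \<odot> e (k + 1)) $ Some m = e (k + 3) $ Some m"
    "(e (k + 1) \<odot> e (k + 3)) $ Some m = e k $ Some m"
    "(e (k + 3) \<odot> e k) $ Some m = e (k + 1) $ Some m" for m
    using shift[of m] by (elim bexE insertE emptyE) (simp_all add: omult_nth e_nth diff_eq_eq add.assoc)
  show "e k \<odot> e (k + 1) = e (k + 3)" "e (k + 1) \<odot> e (k + 3) = e k" "e (k + 3) \<odot> e k = e (k + 1)"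
    by (rule octc_eqI, simp add: omult_nth e_nth mult_delta_left, fact *)+
qed

lemma e_anticommute: "j \<noteq> k \<Longrightarrow> e j \<odot> e k = - (e k \<odot> e j)"
  by (auto intro!: octc_eqI simp: omult_nth e_nth mult_delta_left)

lemma omult_bilinear:
  "(x + y) \<odot> z = x \<odot> z + y \<odot> z" "z \<odot> (x + y) = z \<odot> x + z \<odot> y"
  "(c *s x) \<odot> y = c *s (x \<odot> y)" "x \<odot> (c *s y) = c *s (x \<odot> y)"
  by (auto intro!: octc_eqI simp: omult_nth algebra_simps sum.distrib sum_distrib_left)

lemma oconj_omult: "oconj (x \<odot> y) = oconj y \<odot> oconj x"
  by (auto intro!: octc_eqI simp: omult_nth oconj_nth algebra_simps)

section \<open>The complex Albert algebra\<close>

text \<open>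
  An element is given by its coordinates \<open>(\<xi>, x)\<close>, with \<open>\<xi> = (\<xi>\<^sub>1, \<xi>\<^sub>2, \<xi>\<^sub>3)\<close> and \<open>x = (x\<^sub>1, x\<^sub>2, x\<^sub>3)\<close>, and
  identified with the matrix \<open>albert_matrix (\<xi>, x)\<close>. On this coordinate space the real inner
  product of the library is the one for which \<open>p\<^sub>j, i p\<^sub>j, F\<^sub>j(e\<^sub>k), i F\<^sub>j(e\<^sub>k)\<close> are orthonormal (see
  \<open>albert_orthonormal_basis\<close> below).
\<close>

type_synonym albert = "(complex ^ 3) \<times> (octc ^ 3)"

type_synonym octc_matrix = "octc ^ 3 ^ 3"

definition albert_matrix :: "albert \<Rightarrow> octc_matrix" where
  "albert_matrix A = (let \<xi> = fst A; x = snd A in vector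
     [vector [\<xi> $ 1 *s oone, x $ 3,          oconj (x $ 2)],
      vector [oconj (x $ 3), \<xi> $ 2 *s oone, x $ 1],
      vector [x $ 2,          oconj (x $ 1), \<xi> $ 3 *s oone]])"

definition octc_matrix_mult :: "octc_matrix \<Rightarrow> octc_matrix \<Rightarrow> octc_matrix" where
  "octc_matrix_mult M N = (\<chi> i j. \<Sum>k\<in>UNIV. M $ i $ k \<odot> N $ k $ j)"

text \<open>
  Reads the coordinates off a matrix. It is only applied to matrices in the range of
  \<open>albert_matrix\<close>; the lemma \<open>albert_matrix_jordan\<close> shows that this range is closed under the product.
\<close>

definition albert_coords :: "octc_matrix \<Rightarrow> albert" where
  "albert_coords M =
     (\<chi> j. M $ j $ j $ None, vector [M $ 2 $ 3, M $ 3 $ 1, M $ 1 $ 2])"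

definition jordan :: "albert \<Rightarrow> albert \<Rightarrow> albert" where
  "jordan A B = albert_coords ((1/2) *\<^sub>R
     (octc_matrix_mult (albert_matrix A) (albert_matrix B)
      + octc_matrix_mult (albert_matrix B) (albert_matrix A)))"

lemma albert_coords_matrix: "albert_coords (albert_matrix A) = A"
  by (cases A)
    (simp add: albert_coords_def albert_matrix_def Let_def vec_eq_iff forall_3 oone_def)

lemma albert_matrix_jordan:
  "albert_matrix (jordan A B) = (1/2) *\<^sub>R
     (octc_matrix_mult (albert_matrix A) (albert_matrix B)
      + octc_matrix_mult (albert_matrix B) (albert_matrix A))"
proof -
  define M N where "M = albert_matrix A" and "N = albert_matrix B"
  define H where "H = (1/2) *\<^sub>R (octc_matrix_mult M N + octc_matrix_mult N M)"
  have herm: "oconj (albert_matrix C $ i $ j) = albert_matrix C $ j $ i" for C i j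
    using exhaust_3[of i] exhaust_3[of j]
    by (auto intro!: octc_eqI simp: albert_matrix_def Let_def oconj_nth oone_nth)
  have add: "oconj (x + y) = oconj x + oconj y" for x y
    by (auto intro!: octc_eqI simp: oconj_nth)
  have scale: "oconj (r *\<^sub>R x) = r *\<^sub>R oconj x" for r x
    by (auto intro!: octc_eqI simp: oconj_nth)
  have H_herm: "oconj (H $ i $ j) = H $ j $ i" for i j
    by (simp add: H_def M_def N_def octc_matrix_mult_def sum_3 add scale oconj_omult herm)
  have H_diag: "H $ i $ i = H $ i $ i $ None *s oone" for i
  proof -
    have "oconj (H $ i $ i) $ Some m = H $ i $ i $ Some m" for m
      by (simp add: H_herm)
    then show ?thesis
      by (auto intro!: octc_eqI simp: oconj_nth oone_nth)
  qed
  have "albert_matrix (albert_coords H) = H"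
    by (simp add: albert_matrix_def albert_coords_def Let_def vec_eq_iff[of _ H] forall_3
        vec_eq_iff[of _ "H $ _"] H_herm flip: H_diag)
  then show ?thesis
    by (simp add: jordan_def H_def M_def N_def)
qed

definition p :: "3 \<Rightarrow> albert" where
  "p j = (axis j 1, 0)"

definition F :: "3 \<Rightarrow> octc \<Rightarrow> albert" where
  "F j x = (0, axis j x)"

lemma albert_orthonormal_basis:
  "(Basis :: albert set) =
     (\<Union>j. {p j, (axis j \<i>, 0)}) \<union>
     (\<Union>j. \<Union>u \<in> insert oone (range e). {F j u, F j (\<i> *s u)})"
proof -
  have "axis n \<i> = \<i> *s axis n 1" for n :: "7 option"
    by (simp add: vec_eq_iff axis_def)
  then have octc: "(Basis :: octc set) = (\<Union>u \<in> insert oone (range e). {u, \<i> *s u})"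
    by (simp add: Basis_vec_def Basis_complex_def oone_def e_def UNIV_option_conv insert_commute)
  have octc3: "(Basis :: (octc ^ 3) set) =
      (\<Union>j. \<Union>u \<in> insert oone (range e). {axis j u, axis j (\<i> *s u)})"
    unfolding Basis_vec_def[where 'a = octc] octc by (simp only: UN_UN_flatten) auto
  have complex3: "(Basis :: (complex ^ 3) set) = (\<Union>j. {axis j 1, axis j \<i>})"
    unfolding Basis_vec_def[where 'a = complex] Basis_complex_def by (simp add: insert_commute)
  have image: "Pair 0 ` (\<Union>j. \<Union>u\<in>S. {axis j u, axis j (\<i> *s u)}) =
      (\<Union>j. \<Union>u\<in>S. {(0, axis j u), (0, axis j (\<i> *s u))})" for S :: "octc set"
    by (simp only: image_UN image_insert image_empty)
  show ?thesis
    unfolding Basis_prod_def p_def F_def complex3 octc3 image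
    by (simp only: image_UN[of _ _ UNIV] image_insert image_empty)
qed

section \<open>Operators\<close>

definition L :: "albert \<Rightarrow> albert \<Rightarrow> albert" where
  "L A = (\<lambda>X. jordan A X)"

definition commutator :: "(albert \<Rightarrow> albert) \<Rightarrow> (albert \<Rightarrow> albert) \<Rightarrow> albert \<Rightarrow> albert" where
  "commutator S T = (\<lambda>X. S (T X) - T (S X))"

definition D12 :: "octc \<Rightarrow> albert \<Rightarrow> albert" where
  "D12 z = (\<lambda>X. 2 *\<^sub>R commutator (L (p 1 - p 2)) (L (F 3 z)) X)"

definition D23 :: "octc \<Rightarrow> albert \<Rightarrow> albert" where
  "D23 z = (\<lambda>X. 2 *\<^sub>R commutator (L (p 2 - p 3)) (L (F 1 z)) X)"

definition D31 :: "octc \<Rightarrow> albert \<Rightarrow> albert" where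
  "D31 z = (\<lambda>X. 2 *\<^sub>R commutator (L (p 3 - p 1)) (L (F 2 z)) X)"

definition z12 :: "real \<Rightarrow> octc" where
  "z12 chi = (- cos chi) *\<^sub>R e 3 + sin chi *\<^sub>R e 1"

definition z23 :: "real \<Rightarrow> octc" where
  "z23 chi = cos chi *\<^sub>R e 6 + sin chi *\<^sub>R e 1"

definition z31 :: "real \<Rightarrow> octc" where
  "z31 chi = cos chi *\<^sub>R e 4 + sin chi *\<^sub>R e 1"

definition D_sum ::
  "real \<Rightarrow> real \<Rightarrow> real \<Rightarrow> octc \<Rightarrow> octc \<Rightarrow> octc \<Rightarrow> albert \<Rightarrow> albert" where
  "D_sum \<rho>12 \<rho>23 \<rho>31 u v w =
     (\<lambda>X. \<rho>12 *\<^sub>R D12 u X + \<rho>23 *\<^sub>R D23 v X + \<rho>31 *\<^sub>R D31 w X)"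

definition B_op :: "real \<Rightarrow> real \<Rightarrow> real \<Rightarrow> real \<Rightarrow> albert \<Rightarrow> albert" where
  "B_op chi \<rho>12 \<rho>23 \<rho>31 = D_sum \<rho>12 \<rho>23 \<rho>31 (z12 chi) (z23 chi) (z31 chi)"

section \<open>Projection and matrix representation\<close>

definition orth_proj :: "'a::euclidean_space set \<Rightarrow> 'a \<Rightarrow> 'a" where
  "orth_proj S x = (THE y. y \<in> S \<and> (\<forall>s\<in>S. orthogonal (x - y) s))"

lemma orth_proj_ex1:
  fixes S :: "'a::euclidean_space set"
  assumes "subspace S"
  shows "\<exists>!y. y \<in> S \<and> (\<forall>s\<in>S. orthogonal (x - y) s)"
proof (rule ex_ex1I)
  obtain y z where "y \<in> span S" "\<And>w. w \<in> span S \<Longrightarrow> orthogonal z w" "x = y + z"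
    using orthogonal_subspace_decomp_exists[of S x] by metis
  with assms show "\<exists>y. y \<in> S \<and> (\<forall>s\<in>S. orthogonal (x - y) s)"
    by (intro exI[of _ y]) (simp add: span_eq_iff[THEN iffD2])
next
  fix y y'
  assume y: "y \<in> S \<and> (\<forall>s\<in>S. orthogonal (x - y) s)"
    and y': "y' \<in> S \<and> (\<forall>s\<in>S. orthogonal (x - y') s)"
  then have "y - y' \<in> S"
    using assms by (simp add: subspace_diff)
  with y y' have "(x - y') \<bullet> (y - y') - (x - y) \<bullet> (y - y') = 0"
    by (simp add: orthogonal_def)
  then have "(y - y') \<bullet> (y - y') = 0"
    by (simp add: inner_diff_left)
  then show "y = y'"
    by simp
qed

definition \<nu> :: "3 \<Rightarrow> albert" where
  "\<nu> = ($) (vector [F 3 (\<i> *s e 7), F 1 (\<i> *s e 5), F 2 (\<i> *s e 2)])"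

definition P\<nu> :: "albert \<Rightarrow> albert" where
  "P\<nu> = orth_proj (span {\<nu> 1, \<nu> 2, \<nu> 3})"

text \<open>
  \<open>M\<close> is the matrix of \<open>f\<close>, restricted to the real span of the family \<open>b\<close>, in the basis \<open>b\<close> of
  that span; columns are the images of the basis vectors.
\<close>

definition has_matrix_in_basis ::
  "('a::real_vector \<Rightarrow> 'a) \<Rightarrow> ('n::finite \<Rightarrow> 'a) \<Rightarrow> real ^ 'n ^ 'n \<Rightarrow> bool" where
  "has_matrix_in_basis f b M \<longleftrightarrow>
     inj b \<and> independent (range b) \<and> (\<forall>j. f (b j) = (\<Sum>i\<in>UNIV. M $ i $ j *\<^sub>R b i))"

end

(* The operator D12 z exchanges the first two off-diagonal slots, by octonion multiplication with z
   followed by conjugation: F_1(x) goes to F_2(conj(z x)) and F_2(x) to -F_1(conj(x z)); the other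
   two operators are its cyclic shifts. The projection reads only the i e_7, i e_5, i e_2
   coordinates, so a component e_k of z contributes exactly when e_k completes the relevant pair of
   these units to a triple: e_3 for (e_5, e_2), e_6 for (e_2, e_7), e_4 for (e_7, e_5), never e_1. *)

theory Submission
  imports Defs
begin

lemma oconj_linear:
  "oconj 0 = 0" "oconj (x + y) = oconj x + oconj y" "oconj (- x) = - oconj x"
  "oconj (r *\<^sub>R x) = r *\<^sub>R oconj x"
  by (auto intro!: octc_eqI simp: oconj_nth)

lemma omult_linear:
  "0 \<odot> x = 0" "x \<odot> 0 = 0" "(- x) \<odot> y = - (x \<odot> y)" "x \<odot> (- y) = - (x \<odot> y)"
  "(r *\<^sub>R x) \<odot> y = r *\<^sub>R (x \<odot> y)" "x \<odot> (r *\<^sub>R y) = r *\<^sub>R (x \<odot> y)"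
  by (auto intro!: octc_eqI
      simp: omult_nth scaleR_conv_of_real[where 'a = complex] sum_negf sum_distrib_left algebra_simps)

text \<open>The commutators need the diagonal of a product only when its left factor is diagonal: in
  the order \<open>L (p i - p j) (L (F k z) X)\<close> the diagonal of the inner product meets the
  vanishing off-diagonal part of \<open>p i - p j\<close>.\<close>

lemma fst_jordan_diagonal:
  assumes "snd A = 0"
  shows "fst (jordan A B) $ j = fst A $ j * fst B $ j"
  using exhaust_3[of j] assms
  by (auto simp: jordan_def albert_coords_def octc_matrix_mult_def albert_matrix_def Let_def
      sum_3 omult_bilinear omult_one oone_nth oconj_linear omult_linear
      scaleR_conv_of_real[where 'a = complex])

lemma snd_jordan:
  "snd (jordan A B) $ 1 = (1 / 2) *\<^sub>R ((fst A $ 2 + fst A $ 3) *s snd B $ 1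
    + (fst B $ 2 + fst B $ 3) *s snd A $ 1
    + oconj (snd A $ 2 \<odot> snd B $ 3) + oconj (snd B $ 2 \<odot> snd A $ 3))"
  "snd (jordan A B) $ 2 = (1 / 2) *\<^sub>R ((fst A $ 3 + fst A $ 1) *s snd B $ 2
    + (fst B $ 3 + fst B $ 1) *s snd A $ 2
    + oconj (snd A $ 3 \<odot> snd B $ 1) + oconj (snd B $ 3 \<odot> snd A $ 1))"
  "snd (jordan A B) $ 3 = (1 / 2) *\<^sub>R ((fst A $ 1 + fst A $ 2) *s snd B $ 3
    + (fst B $ 1 + fst B $ 2) *s snd A $ 3
    + oconj (snd A $ 1 \<odot> snd B $ 2) + oconj (snd B $ 1 \<odot> snd A $ 2))"
  by (simp_all add: jordan_def albert_coords_def octc_matrix_mult_def albert_matrix_def Let_def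
      sum_3 omult_bilinear omult_one oconj_omult vector_sadd_rdistrib algebra_simps)

text \<open>On the off-diagonal slots 1, 2, 3 the operator \<open>L (p 1 - p 2)\<close> is scalar
  with values -1/2, 1/2, 0, while \<open>L (F 3 z)\<close> exchanges slots 1 and 2 with a factor
  1/2. Commuting multiplies by the difference of the values, 1 or -1, and the 2 in
  \<open>D12\<close> cancels the 1/2. Slot 3 is fed by the diagonal alone.\<close>

lemma snd_D12:
  "snd (D12 z X) = vector
     [- oconj (snd X $ 2 \<odot> z), oconj (z \<odot> snd X $ 1), (fst X $ 2 - fst X $ 1) *s z]"
  by (simp add: vec_eq_iff[where 'a = octc] forall_3 D12_def commutator_def L_def snd_jordan
      fst_jordan_diagonal p_def F_def axis_def oconj_linear omult_linear)

lemma snd_D23: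
  "snd (D23 z X) = vector
     [(fst X $ 3 - fst X $ 2) *s z, - oconj (snd X $ 3 \<odot> z), oconj (z \<odot> snd X $ 2)]"
  by (simp add: vec_eq_iff[where 'a = octc] forall_3 D23_def commutator_def L_def snd_jordan
      fst_jordan_diagonal p_def F_def axis_def oconj_linear omult_linear)

lemma snd_D31:
  "snd (D31 z X) = vector
     [oconj (z \<odot> snd X $ 3), (fst X $ 1 - fst X $ 3) *s z, - oconj (snd X $ 1 \<odot> z)]"
  by (simp add: vec_eq_iff[where 'a = octc] forall_3 D31_def commutator_def L_def snd_jordan
      fst_jordan_diagonal p_def F_def axis_def oconj_linear omult_linear)

lemma \<nu>_simps:
  "\<nu> 1 = F 3 (\<i> *s e 7)" "\<nu> 2 = F 1 (\<i> *s e 5)" "\<nu> 3 = F 2 (\<i> *s e 2)"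
  by (simp_all add: \<nu>_def)

lemma inner_F_i_e: "Y \<bullet> F j (\<i> *s e k) = Im (snd Y $ j $ Some k)"
proof -
  have "\<i> *s e k = axis (Some k) \<i>"
    by (simp add: e_def vec_eq_iff axis_def)
  then show ?thesis
    by (simp add: F_def inner_prod_def inner_axis inner_complex_def)
qed

lemma inner_\<nu>: "\<nu> i \<bullet> \<nu> j = (if i = j then 1 else 0)"
  using exhaust_3[of i] exhaust_3[of j]
  \<comment> \<open>\<open>F\<close> stays folded in the first pass so that
    \<open>inner_F_i_e\<close> still matches.\<close>
  by (elim disjE) (simp_all add: \<nu>_simps inner_F_i_e, simp_all add: F_def axis_def e_nth)

lemma P\<nu>_eq:
  "P\<nu> Y = Im (snd Y $ 3 $ Some 7) *\<^sub>R \<nu> 1 + Im (snd Y $ 1 $ Some 5) *\<^sub>R \<nu> 2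
    + Im (snd Y $ 2 $ Some 2) *\<^sub>R \<nu> 3" (is "_ = ?y")
proof -
  let ?S = "span {\<nu> 1, \<nu> 2, \<nu> 3}"
  have "?y \<in> ?S"
    by (intro span_add span_scale span_base) auto
  moreover have "orthogonal (Y - ?y) s" if "s \<in> ?S" for s
  proof (rule orthogonal_to_span[OF that])
    fix v assume "v \<in> {\<nu> 1, \<nu> 2, \<nu> 3}"
    moreover have "Y \<bullet> \<nu> 1 = Im (snd Y $ 3 $ Some 7)" "Y \<bullet> \<nu> 2 = Im (snd Y $ 1 $ Some 5)"
      "Y \<bullet> \<nu> 3 = Im (snd Y $ 2 $ Some 2)"
      by (simp_all add: \<nu>_simps inner_F_i_e)
    ultimately show "orthogonal (Y - ?y) v"
      by (auto simp: orthogonal_def inner_diff_left inner_add_left inner_\<nu>)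
  qed
  ultimately show ?thesis
    \<comment> \<open>Existence and uniqueness of the projection make the description by
      \<open>THE\<close> well defined, so the candidate \<open>?y\<close> is its value.\<close>
    unfolding P\<nu>_def orth_proj_def
    by (intro the1_equality orth_proj_ex1 subspace_span) auto
qed

lemma snd_P\<nu>:
  "snd (P\<nu> Y) = vector [Im (snd Y $ 1 $ Some 5) *\<^sub>R (\<i> *s e 5),
     Im (snd Y $ 2 $ Some 2) *\<^sub>R (\<i> *s e 2), Im (snd Y $ 3 $ Some 7) *\<^sub>R (\<i> *s e 7)]"
  by (simp add: vec_eq_iff[where 'a = octc] forall_3 P\<nu>_eq \<nu>_simps F_def axis_def)

text \<open>This kills the diagonal contribution to each operator, leaving only the exchange of two
  slots.\<close>

lemma fst_P\<nu>: "fst (P\<nu> Y) = 0"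
  by (simp add: P\<nu>_eq \<nu>_simps F_def)

text \<open>With free coefficients one computation serves all claims of the theorem. The
  \<open>b\<close> coefficients drop out because \<open>e 1\<close> takes \<open>e 5\<close>,
  \<open>e 2\<close>, \<open>e 7\<close> to \<open>e 6\<close>, \<open>e 4\<close>,
  \<open>e 3\<close> up to sign, and \<open>P\<nu>\<close> reads none of these.\<close>

lemma P\<nu>_D_sum_P\<nu>:
  fixes a12 a23 a31 b12 b23 b31 :: real
  shows "P\<nu> (D_sum \<rho>12 \<rho>23 \<rho>31 (a12 *\<^sub>R e 3 + b12 *\<^sub>R e 1) (a23 *\<^sub>R e 6 + b23 *\<^sub>R e 1)
      (a31 *\<^sub>R e 4 + b31 *\<^sub>R e 1) (P\<nu> X)) =
    (\<rho>23 * a23 * Im (snd X $ 2 $ Some 2) - \<rho>31 * a31 * Im (snd X $ 1 $ Some 5)) *\<^sub>R \<nu> 1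
    + (\<rho>12 * a12 * Im (snd X $ 2 $ Some 2) + \<rho>31 * a31 * Im (snd X $ 3 $ Some 7)) *\<^sub>R \<nu> 2
    + (- \<rho>12 * a12 * Im (snd X $ 1 $ Some 5) - \<rho>23 * a23 * Im (snd X $ 3 $ Some 7)) *\<^sub>R \<nu> 3"
  unfolding P\<nu>_eq[of "D_sum _ _ _ _ _ _ _"]
  by (simp add: D_sum_def snd_D12 snd_D23 snd_D31 fst_P\<nu> snd_P\<nu> omult_nth oconj_nth e_nth
      mult_ac)

lemma P\<nu>_D_e1_P\<nu>:
  "P\<nu> (D12 (r *\<^sub>R e 1) (P\<nu> X)) = 0"
  "P\<nu> (D23 (r *\<^sub>R e 1) (P\<nu> X)) = 0"
  "P\<nu> (D31 (r *\<^sub>R e 1) (P\<nu> X)) = 0"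
  \<comment> \<open>One weight is 1 and the others 0, which isolates a single operator; after the
    weights come the pairs \<open>a12 b12\<close>, \<open>a23 b23\<close>, \<open>a31 b31\<close>,
    with \<open>r\<close> in the matching \<open>b\<close>.\<close>
  using P\<nu>_D_sum_P\<nu>[of 1 0 0 0 r 0 0 0 0 X] P\<nu>_D_sum_P\<nu>[of 0 1 0 0 0 0 r 0 0 X]
    P\<nu>_D_sum_P\<nu>[of 0 0 1 0 0 0 0 0 r X]
  by (simp_all add: D_sum_def)

lemma inj_\<nu>: "inj \<nu>"
  by (rule injI) (metis inner_\<nu> zero_neq_one)

lemma independent_\<nu>: "independent (range \<nu>)"
proof (rule pairwise_orthogonal_independent)
  show "pairwise orthogonal (range \<nu>)"
    by (auto simp: pairwise_def orthogonal_def inner_\<nu>)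
  show "0 \<notin> range \<nu>"
    by (metis imageE inner_\<nu> inner_zero_left zero_neq_one)
qed

theorem mainTheorem9:
  fixes chi \<rho>12 \<rho>23 \<rho>31 :: real
  shows "has_matrix_in_basis (P\<nu> \<circ> B_op chi \<rho>12 \<rho>23 \<rho>31 \<circ> P\<nu>) \<nu>
           (cos chi *\<^sub>R vector [vector [0, - \<rho>31, \<rho>23],
                             vector [\<rho>31, 0, - \<rho>12],
                             vector [- \<rho>23, \<rho>12, 0]])
       \<and> P\<nu> \<circ> B_op chi \<rho>12 \<rho>23 \<rho>31 \<circ> P\<nu>
           = P\<nu> \<circ> D_sum \<rho>12 \<rho>23 \<rho>31 ((- cos chi) *\<^sub>R e 3) (cos chi *\<^sub>R e 6) (cos chi *\<^sub>R e 4) \<circ> P\<nu>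
       \<and> P\<nu> \<circ> D12 (sin chi *\<^sub>R e 1) \<circ> P\<nu> = (\<lambda>X. 0)
       \<and> P\<nu> \<circ> D23 (sin chi *\<^sub>R e 1) \<circ> P\<nu> = (\<lambda>X. 0)
       \<and> P\<nu> \<circ> D31 (sin chi *\<^sub>R e 1) \<circ> P\<nu> = (\<lambda>X. 0)"
proof (intro conjI)
  note B = B_op_def z12_def z23_def z31_def
  let ?M = "cos chi *\<^sub>R vector [vector [0, - \<rho>31, \<rho>23], vector [\<rho>31, 0, - \<rho>12],
    vector [- \<rho>23, \<rho>12, 0]] :: real ^ 3 ^ 3"
  have "(P\<nu> \<circ> B_op chi \<rho>12 \<rho>23 \<rho>31 \<circ> P\<nu>) (\<nu> j) = (\<Sum>i\<in>UNIV. ?M $ i $ j *\<^sub>R \<nu> i)" for j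
    \<comment> \<open>\<open>simp only\<close> applies the general formula before
      \<open>- cos chi\<close> can be pulled out of the scalar multiplication, which would spoil the
      match.\<close>
    using exhaust_3[of j]
    by (elim disjE)
      (simp_all only: o_def B P\<nu>_D_sum_P\<nu>, simp_all add: sum_3 \<nu>_simps,
        simp_all add: F_def axis_def e_nth algebra_simps)
  then show "has_matrix_in_basis (P\<nu> \<circ> B_op chi \<rho>12 \<rho>23 \<rho>31 \<circ> P\<nu>) \<nu> ?M"
    unfolding has_matrix_in_basis_def using inj_\<nu> independent_\<nu> by blast
  show "P\<nu> \<circ> B_op chi \<rho>12 \<rho>23 \<rho>31 \<circ> P\<nu>
      = P\<nu> \<circ> D_sum \<rho>12 \<rho>23 \<rho>31 ((- cos chi) *\<^sub>R e 3) (cos chi *\<^sub>R e 6) (cos chi *\<^sub>R e 4) \<circ> P\<nu>"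
    \<comment> \<open>Setting every \<open>b\<close> to 0 leaves the same value as for
      \<open>B_op\<close>. Again the minus sign has to stay inside the scalar.\<close>
    using P\<nu>_D_sum_P\<nu>[of \<rho>12 \<rho>23 \<rho>31 "- cos chi" 0 "cos chi" 0 "cos chi" 0]
    by (simp add: fun_eq_iff B P\<nu>_D_sum_P\<nu> del: scaleR_minus_left)
qed (simp_all add: fun_eq_iff P\<nu>_D_e1_P\<nu>)

end
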